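(* Let $\mathbf{A}\in\mathbb{R}^{n\times n}$ be symmetric with eigenvalues $\lambda_1\le\cdots\le\lambda_n$ and corresponding orthonormal eigenvectors $\mathbf{v}_1,\dots,\mathbf{v}_n$, let $\mathbf{b}\in\mathbb{R}^n$ with $\mathbf{b}^{\mathrm T}\mathbf{v}_1\neq 0$, let $\rho>0$, and let $1\le m<n$. Then for any $\mu\ge\lambda_m$ the function $$w_1(\sigma;\mu)=\sum_{i=1}^m\frac{c_i^2}{(\lambda_i+\sigma)^2}+\sum_{i=m+1}^n\frac{c_i^2}{(\mu+\sigma)^2}-\frac{\sigma^2}{\rho^2},\qquad c_i=-\mathbf{b}^{\mathrm T}\mathbf{v}_i,$$ admits a unique root $\sigma$ in $(\max\{-\lambda_1,0\},+\infty)$. *)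

theory Defs
  imports "HOL-Analysis.Analysis"
begin

definition is_eigenvector :: "real ^ 'n ^ 'n \<Rightarrow> real ^ 'n \<Rightarrow> real \<Rightarrow> bool" where
  "is_eigenvector A v k \<longleftrightarrow> v \<noteq> 0 \<and> A *v v = k *\<^sub>R v"

(* Indices run over 1..n, and in the intended use n is the dimension of the space. *)
definition w1 ::
  "nat \<Rightarrow> nat \<Rightarrow> (nat \<Rightarrow> real) \<Rightarrow> (nat \<Rightarrow> real) \<Rightarrow> real \<Rightarrow> real \<Rightarrow> real \<Rightarrow> real" where
  "w1 n m lam c \<rho> \<mu> \<sigma> =
     (\<Sum>i = 1..m. (c i)\<^sup>2 / (lam i + \<sigma>)\<^sup>2)
     + (\<Sum>i = m + 1..n. (c i)\<^sup>2 / (\<mu> + \<sigma>)\<^sup>2)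
     - \<sigma>\<^sup>2 / \<rho>\<^sup>2"

end

theory Submission
  imports Defs
begin

text \<open>
  The function has the form \<open>\<Sum>i. a i / (d i + \<sigma>)\<^sup>2 - \<sigma>\<^sup>2 / \<rho>\<^sup>2\<close> with \<open>a i \<ge> 0\<close>, where the
  least \<open>d i\<close> is attained at an index \<open>k\<close> with \<open>a k > 0\<close>. To the right of \<open>L = max (- d k) 0\<close> it
  is continuous and strictly decreasing. Near \<open>L\<close> the \<open>k\<close>-th term alone beats \<open>\<sigma>\<^sup>2 / \<rho>\<^sup>2\<close>, because
  \<open>\<sigma> (d k + \<sigma>)\<close> vanishes at \<open>L\<close> for either sign of \<open>d k\<close>; for large \<open>\<sigma>\<close> the sum is bounded.
\<close>

definition secular :: "'i set \<Rightarrow> ('i \<Rightarrow> real) \<Rightarrow> ('i \<Rightarrow> real) \<Rightarrow> real \<Rightarrow> real \<Rightarrow> real" where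
  "secular I a d \<rho> \<sigma> = (\<Sum>i\<in>I. a i / (d i + \<sigma>)\<^sup>2) - \<sigma>\<^sup>2 / \<rho>\<^sup>2"

text \<open>The weights may vanish, so the sum is only known to decrease weakly. Strictness comes
  from the quadratic term, hence the requirement \<open>0 \<le> x\<close>.\<close>

lemma secular_strict_decreasing:
  assumes a: "\<And>i. i \<in> I \<Longrightarrow> 0 \<le> a i"
    and d: "\<And>i. i \<in> I \<Longrightarrow> 0 < d i + x"
    and "\<rho> > 0" "0 \<le> x" "x < y"
  shows "secular I a d \<rho> y < secular I a d \<rho> x"
proof -
  have "(\<Sum>i\<in>I. a i / (d i + y)\<^sup>2) \<le> (\<Sum>i\<in>I. a i / (d i + x)\<^sup>2)"
  proof (rule sum_mono)
    fix i assume "i \<in> I"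
    then show "a i / (d i + y)\<^sup>2 \<le> a i / (d i + x)\<^sup>2"
      using a[of i] d[of i] \<open>x < y\<close> by (intro divide_left_mono power_mono mult_pos_pos) auto
  qed
  moreover have "x\<^sup>2 / \<rho>\<^sup>2 < y\<^sup>2 / \<rho>\<^sup>2"
    using assms by (intro divide_strict_right_mono power_strict_mono) auto
  ultimately show ?thesis by (simp add: secular_def)
qed

lemma secular_pos_near:
  assumes fin: "finite I" and k: "k \<in> I" "0 < a k"
    and a: "\<And>i. i \<in> I \<Longrightarrow> 0 \<le> a i" and "\<rho> > 0"
  shows "\<exists>s > max (- d k) 0. 0 < secular I a d \<rho> s"
proof -
  define L where "L = max (- d k) 0"
  \<comment> \<open>For \<open>s > L\<close> both factors are positive, so clearing denominators and
    taking roots turns \<open>s\<^sup>2 / \<rho>\<^sup>2 < a k / (d k + s)\<^sup>2\<close> into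
    \<open>g s < \<rho> * sqrt (a k)\<close>.\<close>
  define g where "g s = s * (d k + s)" for s
  have "(g \<longlongrightarrow> g L) (at_right L)"
    unfolding g_def by (intro tendsto_intros)
  moreover have "g L = 0" by (auto simp: g_def L_def max_def)
  moreover have pos: "0 < \<rho> * sqrt (a k)" using assms by simp
  ultimately have "eventually (\<lambda>s. g s < \<rho> * sqrt (a k)) (at_right L)"
    by (simp add: order_tendsto_iff)
  then have "eventually (\<lambda>s. g s < \<rho> * sqrt (a k) \<and> L < s) (at_right L)"
    by (simp add: eventually_conj eventually_at_right_less)
  then obtain s where s: "g s < \<rho> * sqrt (a k)" "L < s"
    using eventually_happens trivial_limit_at_right_real by blast
  then have pos_s: "0 < s" "0 < d k + s" by (auto simp: L_def)
  have "(g s)\<^sup>2 < (\<rho> * sqrt (a k))\<^sup>2"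
    using s pos_s by (intro power_strict_mono) (auto simp: g_def)
  then have "s\<^sup>2 * (d k + s)\<^sup>2 < a k * \<rho>\<^sup>2"
    using k by (simp add: g_def power_mult_distrib mult.commute)
  then have "s\<^sup>2 / \<rho>\<^sup>2 < a k / (d k + s)\<^sup>2"
    using pos_s \<open>\<rho> > 0\<close> by (simp add: divide_simps)
  also have "\<dots> \<le> (\<Sum>i\<in>I. a i / (d i + s)\<^sup>2)"
    using fin k a by (intro member_le_sum) auto
  finally show ?thesis using s by (auto simp: secular_def L_def)
qed

text \<open>Leaving \<open>s\<close> arbitrary allows the negative value to be placed to the right
  of a positive one, as the intermediate value theorem needs.\<close>

lemma secular_neg_far:
  assumes a: "\<And>i. i \<in> I \<Longrightarrow> 0 \<le> a i" and d: "\<And>i. i \<in> I \<Longrightarrow> \<delta> \<le> d i"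
    and "\<rho> > 0"
  shows "\<exists>t > s. secular I a d \<rho> t < 0"
proof -
  define C where "C = (\<Sum>i\<in>I. a i)"
  have C: "0 \<le> C" unfolding C_def by (intro sum_nonneg a)
  \<comment> \<open>The part \<open>\<bar>\<delta>\<bar> + 1\<close> makes every denominator at
    least 1, bounding the sum by \<open>C\<close>; the part \<open>\<rho> * sqrt C\<close> makes the
    quadratic term exceed \<open>C\<close>.\<close>
  define t where "t = \<bar>s\<bar> + \<bar>\<delta>\<bar> + 1 + \<rho> * sqrt C"
  have nn: "0 \<le> \<rho> * sqrt C" using C \<open>\<rho> > 0\<close> by simp
  then have t: "s < t" "1 \<le> \<delta> + t" "\<rho> * sqrt C < t" by (auto simp: t_def)
  have "(\<Sum>i\<in>I. a i / (d i + t)\<^sup>2) \<le> C"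
    unfolding C_def
  proof (rule sum_mono)
    fix i assume "i \<in> I"
    then have "1 \<le> (d i + t)\<^sup>2" using d[of i] t by (intro one_le_power) auto
    then show "a i / (d i + t)\<^sup>2 \<le> a i"
      using a[OF \<open>i \<in> I\<close>] divide_left_mono[of 1 "(d i + t)\<^sup>2" "a i"] by force
  qed
  also have "(\<rho> * sqrt C)\<^sup>2 < t\<^sup>2" using t nn by (intro power_strict_mono) auto
  then have "C < t\<^sup>2 / \<rho>\<^sup>2"
    using C \<open>\<rho> > 0\<close> by (simp add: power_mult_distrib field_simps)
  finally show ?thesis using t by (auto simp: secular_def)
qed

lemma secular_ex1_root:
  assumes fin: "finite I" and k: "k \<in> I" "0 < a k"
    and a: "\<And>i. i \<in> I \<Longrightarrow> 0 \<le> a i" and d: "\<And>i. i \<in> I \<Longrightarrow> d k \<le> d i"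
    and \<rho>: "\<rho> > 0"
  shows "\<exists>!\<sigma>. \<sigma> \<in> {max (- d k) 0 <..} \<and> secular I a d \<rho> \<sigma> = 0"
proof -
  let ?L = "max (- d k) 0"
  \<comment> \<open>As \<open>d k\<close> is least, no pole \<open>- d i\<close> lies to the right
    of \<open>?L\<close>; this yields both continuity and monotonicity there.\<close>
  have dpos: "0 < d i + x" if "i \<in> I" "?L < x" for i x
    using d[OF that(1)] that(2) by auto
  obtain s where s: "?L < s" "0 < secular I a d \<rho> s"
    using secular_pos_near[of I k a \<rho> d] fin k a \<rho> by blast
  obtain t where t: "s < t" "secular I a d \<rho> t < 0"
    using secular_neg_far[of I a "d k" d \<rho> s] a d \<rho> by blast
  have "continuous_on {s..t} (secular I a d \<rho>)"
    unfolding secular_def using dpos s \<rho> by (intro continuous_intros) fastforce+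
  then obtain r where r: "s \<le> r" "secular I a d \<rho> r = 0"
    using IVT2'[of "secular I a d \<rho>" t 0 s] s t by auto
  have less: "secular I a d \<rho> y < secular I a d \<rho> x" if "?L < x" "x < y" for x y
    using that dpos by (intro secular_strict_decreasing a \<rho>) auto
  show ?thesis
  proof (rule ex1I[of _ r])
    show "r \<in> {?L<..} \<and> secular I a d \<rho> r = 0" using r s by auto
  next
    fix x assume x: "x \<in> {?L<..} \<and> secular I a d \<rho> x = 0"
    show "x = r"
      using less[of x r] less[of r x] x r s by (cases x r rule: linorder_cases) auto
  qed
qed

text \<open>Giving every index beyond \<open>m\<close> the shift \<open>\<mu>\<close> merges the two
  sums of \<open>w1\<close> into one.\<close>

lemma w1_eq_secular:
  assumes "m \<le> n"
  shows "w1 n m lam c \<rho> \<mu> = secular {1..n} (\<lambda>i. (c i)\<^sup>2) (\<lambda>i. if i \<le> m then lam i else \<mu>) \<rho>"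
proof
  fix \<sigma>
  have "{1..n} = {1..m} \<union> {m + 1..n}" "{1..m} \<inter> {m + 1..n} = {}" using assms by auto
  then show "w1 n m lam c \<rho> \<mu> \<sigma> =
      secular {1..n} (\<lambda>i. (c i)\<^sup>2) (\<lambda>i. if i \<le> m then lam i else \<mu>) \<rho> \<sigma>"
    by (simp add: w1_def secular_def sum.union_disjoint)
qed

theorem lemma1:
  fixes A :: "real ^ 'n ^ 'n"
    and lam :: "nat \<Rightarrow> real"
    and v :: "nat \<Rightarrow> real ^ 'n"
    and b :: "real ^ 'n"
    and \<rho> \<mu> :: real
    and m :: nat
  assumes "transpose A = A"
    and "\<And>i. i \<in> {1..CARD('n)} \<Longrightarrow> is_eigenvector A (v i) (lam i)"
    and "mono_on {1..CARD('n)} lam"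
    and "\<And>i j. i \<in> {1..CARD('n)} \<Longrightarrow> j \<in> {1..CARD('n)} \<Longrightarrow>
           v i \<bullet> v j = (if i = j then 1 else 0)"
    and "b \<bullet> v 1 \<noteq> 0"
    and "\<rho> > 0"
    and "1 \<le> m" and "m < CARD('n)"
    and "\<mu> \<ge> lam m"
  shows "\<exists>!\<sigma>. \<sigma> \<in> {max (- lam 1) 0 <..} \<and>
           w1 CARD('n) m lam (\<lambda>i. - (b \<bullet> v i)) \<rho> \<mu> \<sigma> = 0"
proof -
  let ?d = "\<lambda>i. if i \<le> m then lam i else \<mu>"
  have mono: "lam 1 \<le> lam i" if "1 \<le> i" "i \<le> m" for i
    using that assms by (intro mono_onD[OF assms(3)]) auto
  \<comment> \<open>Beyond \<open>m\<close> this is \<open>lam 1 \<le> lam m \<le> \<mu>\<close>. So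
    index 1 serves as \<open>k\<close>, its weight being positive because
    \<open>b \<bullet> v 1 \<noteq> 0\<close>.\<close>
  have "?d 1 \<le> ?d i" if "i \<in> {1..CARD('n)}" for i
    using that mono[of i] mono[of m] assms by auto
  then have "\<exists>!\<sigma>. \<sigma> \<in> {max (- ?d 1) 0 <..} \<and>
      secular {1..CARD('n)} (\<lambda>i. (- (b \<bullet> v i))\<^sup>2) ?d \<rho> \<sigma> = 0"
    using assms by (intro secular_ex1_root) auto
  then show ?thesis
    using assms by (simp add: w1_eq_secular)
qed

end
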